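(* Let $\mathfrak{A}$ be a unital $C^*$-algebra and let $x\in\mathfrak{A}$. Then the following statements are equivalent: (i) $v(x)=\frac12\|x\|$. (ii) $\|x\| = \|\operatorname{Re}(e^{i\theta}x)\| + \|\operatorname{Im}(e^{i\theta}x)\|$ for all $\theta\in\mathbb{R}$.
   Context: $\mathfrak{A}$ is a (nonzero, complex) $C^*$-algebra with unit $e$. For $x\in\mathfrak{A}$, $\operatorname{Re}(x)=\frac12(x+x^* )$ and $\operatorname{Im}(x)=\frac{1}{2i}(x-x^* )$. The set of normalized states is $\mathcal{S}(\mathfrak{A})=\{\varphi\in\mathfrak{A}':\varphi(e)=\|\varphi\|=1\}$, where $\mathfrak{A}'$ is the dual space of $\mathfrak{A}$. The numerical radius of $x$ is $v(x)=\sup\{|\varphi(x)|:\varphi\in\mathcal{S}(\mathfrak{A})\}$. *)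

theory Defs
  imports "HOL-Analysis.Analysis"
begin

(* Nonzero unital complex C*-algebras.  The superclasses contribute the complete norm,
   submultiplicativity, 0 ~= 1 and norm 1 = 1; the latter holds in every nonzero
   unital C*-algebra.  The underlying real scalar multiplication is tied to the
   complex one by scaleR_scaleC. *)
class unital_cstar_algebra = real_normed_algebra_1 + banach +
  fixes scaleC :: "complex \<Rightarrow> 'a \<Rightarrow> 'a" (infixr "*\<^sub>C" 75)
    and star :: "'a \<Rightarrow> 'a"
  assumes scaleC_add_right: "c *\<^sub>C (x + y) = c *\<^sub>C x + c *\<^sub>C y"
    and scaleC_add_left: "(c + d) *\<^sub>C x = c *\<^sub>C x + d *\<^sub>C x"
    and scaleC_scaleC: "c *\<^sub>C (d *\<^sub>C x) = (c * d) *\<^sub>C x"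
    and scaleC_one: "1 *\<^sub>C x = x"
    and scaleR_scaleC: "r *\<^sub>R x = complex_of_real r *\<^sub>C x"
    and mult_scaleC_left: "(c *\<^sub>C x) * y = c *\<^sub>C (x * y)"
    and mult_scaleC_right: "x * (c *\<^sub>C y) = c *\<^sub>C (x * y)"
    and norm_scaleC: "norm (c *\<^sub>C x) = cmod c * norm x"
    and star_star: "star (star x) = x"
    and star_add: "star (x + y) = star x + star y"
    and star_scaleC: "star (c *\<^sub>C x) = cnj c *\<^sub>C star x"
    and star_mult: "star (x * y) = star y * star x"
    and cstar_identity: "norm (star x * x) = (norm x)\<^sup>2"

definition re_part :: "'a::unital_cstar_algebra \<Rightarrow> 'a" where
  "re_part x = (1 / 2) *\<^sub>C (x + star x)"

definition im_part :: "'a::unital_cstar_algebra \<Rightarrow> 'a" where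
  "im_part x = (1 / (2 * \<i>)) *\<^sub>C (x - star x)"

definition dual_space :: "('a::unital_cstar_algebra \<Rightarrow> complex) set" where
  "dual_space = {\<phi>. bounded_linear \<phi> \<and> (\<forall>c x. \<phi> (c *\<^sub>C x) = c * \<phi> x)}"

definition states :: "('a::unital_cstar_algebra \<Rightarrow> complex) set" where
  "states = {\<phi> \<in> dual_space. \<phi> 1 = 1 \<and> onorm \<phi> = 1}"

(* The supremum is taken in the reals: the set is bounded by norm x, and it is nonempty
   since every nonzero unital C*-algebra has a state. *)
definition numerical_radius :: "'a::unital_cstar_algebra \<Rightarrow> real" where
  "numerical_radius x = (SUP \<phi>\<in>states. cmod (\<phi> x))"

end

theory Submission
  imports Defs
begin

text \<open>Write \<open>y = e\<^sup>i\<^sup>\<theta> x = a + ib\<close> with \<open>a\<close>, \<open>b\<close> self-adjoint. States are real on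
  self-adjoint elements and norm them, so \<open>v(x)\<close> is the supremum of \<open>\<parallel>Re y\<parallel>\<close> over \<open>\<theta>\<close>; this
  gives (i) \<open>\<Longrightarrow>\<close> (ii) by the triangle inequality. Conversely, \<open>\<parallel>a + ib\<parallel> = \<parallel>a\<parallel> + \<parallel>b\<parallel>\<close> forces
  \<open>\<parallel>a \<plusminus> b\<parallel>\<^sup>2 \<ge> \<parallel>a\<parallel>\<^sup>2 + \<parallel>b\<parallel>\<^sup>2\<close>. As \<open>(a \<minusplus> b) / \<surd>2\<close> are the real and imaginary parts of \<open>y\<close> rotated by
  \<open>\<pi> / 4\<close>, (ii) yields \<open>\<parallel>a\<parallel> + \<parallel>b\<parallel> \<ge> \<surd>2 (\<parallel>a\<parallel>\<^sup>2 + \<parallel>b\<parallel>\<^sup>2)\<^sup>1\<^sup>/\<^sup>2\<close>, hence \<open>\<parallel>a\<parallel> = \<parallel>b\<parallel> = \<parallel>x\<parallel> / 2\<close> for all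
  \<open>\<theta>\<close>. A state norming a self-adjoint \<open>a\<close> of norm one is obtained from the Hahn-Banach theorem and
  the identity \<open>max \<parallel>1 + a\<parallel> \<parallel>1 - a\<parallel> = 2\<close>.\<close>

subsection \<open>Norming functionals\<close>

definition sublinear :: "('a::real_vector \<Rightarrow> real) \<Rightarrow> bool" where
  "sublinear q \<longleftrightarrow> (\<forall>x y. q (x + y) \<le> q x + q y) \<and> (\<forall>r\<ge>0. \<forall>x. q (r *\<^sub>R x) = r * q x)"

text \<open>One inequality suffices: applied with \<open>inverse r\<close> to
  \<open>r *\<^sub>R x\<close> it gives the reverse one.\<close>

lemma sublinearI:
  assumes "\<And>x y. q (x + y) \<le> q x + q y" and "q 0 = 0"
    and "\<And>r x. r > 0 \<Longrightarrow> q (r *\<^sub>R x) \<le> r * q x"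
  shows "sublinear q"
proof -
  have "q (r *\<^sub>R x) = r * q x" if "r \<ge> 0" for r x
  proof (cases "r = 0")
    case False
    with that have r: "r > 0" by simp
    have "q (inverse r *\<^sub>R (r *\<^sub>R x)) \<le> inverse r * q (r *\<^sub>R x)"
      by (rule assms(3)) (use r in simp)
    then have "r * q x \<le> q (r *\<^sub>R x)" using r by (simp add: field_simps)
    with assms(3)[OF r, of x] show ?thesis by simp
  qed (simp add: assms(2))
  with assms(1) show ?thesis unfolding sublinear_def by blast
qed

lemma sublinear_add: "sublinear q \<Longrightarrow> q (x + y) \<le> q x + q y"
  and sublinear_scaleR: "sublinear q \<Longrightarrow> 0 \<le> r \<Longrightarrow> q (r *\<^sub>R x) = r * q x"
  by (simp_all add: sublinear_def)

lemma sublinear_zero: "sublinear q \<Longrightarrow> q 0 = 0"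
  using sublinear_scaleR[of q 0 0] by simp

lemma sublinear_minus_le: "sublinear q \<Longrightarrow> - q (- x) \<le> q x"
  using sublinear_add[of q x "- x"] sublinear_zero[of q] by simp

text \<open>The witness is the infimum of \<open>q\<close> along the ray in direction
  \<open>y\<close>, with the growth \<open>t * q y\<close> subtracted. Subadditivity keeps it above
  \<open>- q (- x)\<close>, hence finite; \<open>t = 0\<close> bounds it by \<open>q\<close>, and
  \<open>t = 1\<close> at \<open>- y\<close> gives the last property.\<close>

lemma sublinear_shift:
  fixes q :: "'a::real_vector \<Rightarrow> real"
  assumes q: "sublinear q"
  obtains q' where "sublinear q'" "\<And>x. q' x \<le> q x" "q' (- y) \<le> - q y"
proof -
  define f where "f x t = q (x + t *\<^sub>R y) - t * q y" for x t
  define q' where "q' x = (INF t\<in>{0..}. f x t)" for x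
  have lower: "- q (- x) \<le> f x t" if "t \<ge> 0" for x t
    using sublinear_add[OF q, of "x + t *\<^sub>R y" "- x"] sublinear_scaleR[OF q that, of y]
    by (simp add: f_def)
  then have bdd: "bdd_below (f x ` {0..})" for x
    by (intro bdd_belowI2[where m = "- q (- x)"]) auto
  have q'_le: "q' x \<le> f x t" if "t \<ge> 0" for x t
    unfolding q'_def using that by (intro cINF_lower bdd) auto
  have q'_ge: "c \<le> q' x" if "\<And>t. t \<ge> 0 \<Longrightarrow> c \<le> f x t" for c x
    unfolding q'_def using that by (intro cINF_greatest) auto
  have "sublinear q'"
  proof (rule sublinearI)
    fix x z
    have "q' (x + z) - f z t \<le> f x s" if "s \<ge> 0" "t \<ge> 0" for s t
      using q'_le[of "s + t" "x + z"] sublinear_add[OF q, of "x + s *\<^sub>R y" "z + t *\<^sub>R y"] that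
      by (simp add: f_def algebra_simps)
    then have "q' (x + z) - f z t \<le> q' x" if "t \<ge> 0" for t
      using that by (intro q'_ge) auto
    then have "q' (x + z) - q' x \<le> q' z"
      by (intro q'_ge) (auto simp: algebra_simps)
    then show "q' (x + z) \<le> q' x + q' z" by simp
  next
    show "q' 0 = 0"
      using q'_le[of 0 0] lower[of _ 0] q'_ge[of 0 0] sublinear_zero[OF q]
      by (force simp: f_def)
  next
    fix r :: real and x assume r: "r > 0"
    have "q' (r *\<^sub>R x) / r \<le> f x t" if "t \<ge> 0" for t
      using q'_le[of "r * t" "r *\<^sub>R x"] sublinear_scaleR[OF q, of r "x + t *\<^sub>R y"] r that
      by (simp add: f_def field_simps scaleR_add_right)
    then have "q' (r *\<^sub>R x) / r \<le> q' x" by (rule q'_ge)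
    then show "q' (r *\<^sub>R x) \<le> r * q' x" using r by (simp add: field_simps)
  qed
  moreover have "q' x \<le> q x" for x using q'_le[of 0 x] by (simp add: f_def)
  moreover have "q' (- y) \<le> - q y" using q'_le[of 1 "- y"] sublinear_zero[OF q] by (simp add: f_def)
  ultimately show thesis by (rule that)
qed

text \<open>Pointwise infima bound chains in the use of Zorn's lemma. The majorant \<open>p\<close>
  keeps them finite, since \<open>- p (- x) \<le> q x\<close> for every \<open>q\<close> in
  \<open>C\<close>.\<close>

lemma sublinear_INF_chain:
  fixes C :: "('a::real_vector \<Rightarrow> real) set"
  assumes "C \<noteq> {}" and sub: "\<And>q. q \<in> C \<Longrightarrow> sublinear q"
    and chain: "\<And>q r. q \<in> C \<Longrightarrow> r \<in> C \<Longrightarrow> q \<le> r \<or> r \<le> q"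
    and le: "\<And>q. q \<in> C \<Longrightarrow> q \<le> p"
  shows "sublinear (\<lambda>x. INF q\<in>C. q x)" and "q \<in> C \<Longrightarrow> (INF q\<in>C. q x) \<le> q x"
proof -
  have "- p (- x) \<le> q x" if "q \<in> C" for q x
    using sublinear_minus_le[OF sub[OF that], of x] le[OF that] by (smt (verit) le_fun_def)
  then have bdd: "bdd_below ((\<lambda>q. q x) ` C)" for x
    by (intro bdd_belowI2[where m = "- p (- x)"]) auto
  let ?m = "\<lambda>x. INF q\<in>C. q x"
  show m_le: "?m x \<le> q x" if "q \<in> C" for q x
    using that by (intro cINF_lower bdd)
  have m_ge: "c \<le> ?m x" if "\<And>q. q \<in> C \<Longrightarrow> c \<le> q x" for c x
    using that assms(1) by (intro cINF_greatest) auto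
  show "sublinear ?m"
  proof (rule sublinearI)
    fix x y
    have "?m (x + y) - r y \<le> q x" if qr: "q \<in> C" "r \<in> C" for q r
    proof -
      \<comment> \<open>The smaller of \<open>q\<close> and \<open>r\<close> is a single functional
        whose subadditivity can be used for both.\<close>
      obtain s where s: "s \<in> C" "s \<le> q" "s \<le> r" using chain[OF qr] qr by blast
      show ?thesis
        using m_le[OF s(1), of "x + y"] sublinear_add[OF sub[OF s(1)], of x y] s
        by (smt (verit) le_fun_def)
    qed
    then have "?m (x + y) - r y \<le> ?m x" if "r \<in> C" for r
      using that by (intro m_ge) auto
    then have "?m (x + y) - ?m x \<le> ?m y"
      by (intro m_ge) (auto simp: algebra_simps)
    then show "?m (x + y) \<le> ?m x + ?m y" by simp
  next
    show "?m 0 = 0" using assms(1) sub by (simp add: sublinear_zero)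
  next
    fix r :: real and x assume r: "r > 0"
    have "?m (r *\<^sub>R x) / r \<le> q x" if "q \<in> C" for q
      using m_le[OF that, of "r *\<^sub>R x"] sublinear_scaleR[OF sub[OF that], of r x] r
      by (simp add: field_simps)
    then have "?m (r *\<^sub>R x) / r \<le> ?m x" by (rule m_ge)
    then show "?m (r *\<^sub>R x) \<le> r * ?m x" using r by (simp add: field_simps)
  qed
qed

text \<open>A minimal sublinear functional is linear, because \<open>sublinear_shift\<close> makes it odd.\<close>

lemma Hahn_Banach_sublinear:
  fixes p :: "'a::real_vector \<Rightarrow> real"
  assumes p: "sublinear p"
  obtains f where "linear f" "\<And>x. f x \<le> p x"
proof -
  let ?A = "{q. sublinear q \<and> q \<le> p}"
  have "\<exists>m\<in>?A. \<forall>q\<in>?A. m \<ge> q \<longrightarrow> q = m"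
  \<comment> \<open>The order is reversed, so that maximal elements are minimal functionals.\<close>
  proof (rule predicate_Zorn)
    show "partial_order_on ?A (relation_of (\<lambda>x y. x \<ge> y) ?A)"
      by (rule partial_order_on_relation_ofI) auto
  next
    fix C assume C: "C \<in> Chains (relation_of (\<lambda>x y. x \<ge> y) ?A)"
    show "\<exists>u\<in>?A. \<forall>q\<in>C. q \<ge> u"
    proof (cases "C = {}")
      case True
      with p show ?thesis by auto
    next
      case False
      have sub: "sublinear q" "q \<le> p" if "q \<in> C" for q
        using C that by (auto simp: Chains_def relation_of_def)
      have chain: "q \<le> r \<or> r \<le> q" if "q \<in> C" "r \<in> C" for q r
        using C that by (auto simp: Chains_def relation_of_def)
      have INF: "sublinear (\<lambda>x. INF q\<in>C. q x)"
        using False sub chain by (intro sublinear_INF_chain(1)[of C p]) assumption+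
      have "(\<lambda>x. INF q\<in>C. q x) \<le> q" if "q \<in> C" for q
        using False sub chain that
        by (intro le_funI, intro sublinear_INF_chain(2)[of C p q]) assumption+
      moreover from this have "(\<lambda>x. INF q\<in>C. q x) \<le> p"
        using False sub(2) by (meson all_not_in_conv order_trans)
      ultimately show ?thesis using INF by blast
    qed
  qed
  then obtain f where f: "sublinear f" "f \<le> p"
    and min: "\<And>q. sublinear q \<Longrightarrow> q \<le> p \<Longrightarrow> q \<le> f \<Longrightarrow> q = f" by auto
  have odd: "f (- y) = - f y" for y
  proof -
    obtain q where q: "sublinear q" "\<And>x. q x \<le> f x" "q (- y) \<le> - f y"
      using sublinear_shift[OF f(1)] by blast
    then have "q \<le> f" by (simp add: le_fun_def)
    with f(2) have "q = f" by (intro min q(1)) auto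
    with q(3) sublinear_minus_le[OF f(1), of y] show ?thesis by simp
  qed
  have "linear f"
  proof (rule linearI)
    fix x y
    show "f (x + y) = f x + f y"
      using sublinear_add[OF f(1), of x y] sublinear_add[OF f(1), of "- x" "- y"]
        odd[of x] odd[of y] odd[of "x + y"] by simp
  next
    fix r x
    show "f (r *\<^sub>R x) = r *\<^sub>R f x"
      using sublinear_scaleR[OF f(1), of r x] sublinear_scaleR[OF f(1), of "- r" x]
        odd[of "r *\<^sub>R x"] by (cases "r \<ge> 0") auto
  qed
  with f(2) that show thesis by (auto simp: le_fun_def)
qed

text \<open>Shifting the norm along \<open>y\<close> first gives
  \<open>q (- y) \<le> - norm y\<close>, so every linear functional below \<open>q\<close> is at
  least \<open>norm y\<close> at \<open>y\<close>.\<close>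

lemma norming_functional:
  fixes y :: "'a::real_normed_vector"
  obtains f where "linear f" "\<And>x. f x \<le> norm x" "f y = norm y"
proof -
  have "sublinear (norm :: 'a \<Rightarrow> real)"
    by (auto simp: sublinear_def norm_triangle_ineq)
  then obtain q where q: "sublinear q" "\<And>x. q x \<le> norm x" "q (- y) \<le> - norm y"
    using sublinear_shift by blast
  obtain f where f: "linear f" "\<And>x. f x \<le> q x"
    using Hahn_Banach_sublinear[OF q(1)] by blast
  have "f x \<le> norm x" for x using f(2)[of x] q(2)[of x] by simp
  moreover have "f y = norm y"
    using calculation[of y] f(2)[of "- y"] q(3) linear_neg[OF f(1), of y] by simp
  ultimately show thesis using f(1) that by blast
qed

subsection \<open>Self-adjoint elements\<close>

lemma suminf_power_commute:
  fixes x z :: "'a::{real_normed_algebra_1,banach}"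
  assumes "summable (\<lambda>n. c n *\<^sub>R x ^ n)" and "z * x = x * z"
  shows "z * (\<Sum>n. c n *\<^sub>R x ^ n) = (\<Sum>n. c n *\<^sub>R x ^ n) * z"
proof -
  have "z * (\<Sum>n. c n *\<^sub>R x ^ n) = (\<Sum>n. z * (c n *\<^sub>R x ^ n))"
    using assms(1) by (rule suminf_mult[symmetric])
  also have "\<dots> = (\<Sum>n. (c n *\<^sub>R x ^ n) * z)"
    by (simp add: power_commuting_commutes[OF assms(2)[symmetric]])
  also have "\<dots> = (\<Sum>n. c n *\<^sub>R x ^ n) * z"
    using assms(1) by (rule suminf_mult2[symmetric])
  finally show ?thesis .
qed

text \<open>The binomial series with exponent 1/2, squared as a Cauchy product: by Vandermonde's
  identity the coefficients become those of exponent 1, which vanish from degree 2 on.\<close>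

lemma exists_sqrt_one_plus:
  fixes x :: "'a::{real_normed_algebra_1,banach}"
  assumes "norm x < 1"
  obtains c :: "nat \<Rightarrow> real" where "summable (\<lambda>n. c n *\<^sub>R x ^ n)"
    and "(\<Sum>n. c n *\<^sub>R x ^ n) * (\<Sum>n. c n *\<^sub>R x ^ n) = 1 + x"
proof -
  define c :: "nat \<Rightarrow> real" where "c n = (1 / 2) gchoose n" for n
  let ?f = "\<lambda>n. c n *\<^sub>R x ^ n"
  \<comment> \<open>Convergence at an intermediate radius yields absolute convergence at
    \<open>norm x\<close>.\<close>
  obtain r where r: "norm x < r" "r < 1" using dense[OF assms] by blast
  then have "summable (\<lambda>n. c n * r ^ n)"
    unfolding c_def using gen_binomial_real[of r "1/2"] norm_ge_zero[of x]
    by (intro sums_summable) auto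
  then have "summable (\<lambda>n. norm (c n * norm x ^ n))"
    by (rule powser_insidea) (use r in simp)
  then have abs: "summable (\<lambda>n. norm (?f n))"
    by (rule summable_comparison_test'[where N = 0])
       (simp add: abs_mult mult_left_mono norm_power_ineq)
  have "(\<Sum>i\<le>n. ?f i * ?f (n - i)) = ((1::real) gchoose n) *\<^sub>R x ^ n" for n
  proof -
    have "(\<Sum>i\<le>n. ?f i * ?f (n - i)) = (\<Sum>i\<le>n. (c i * c (n - i)) *\<^sub>R x ^ n)"
      by (intro sum.cong) (simp_all flip: power_add)
    also have "\<dots> = (\<Sum>i=0..n. c i * c (n - i)) *\<^sub>R x ^ n"
      by (simp add: scaleR_sum_left atMost_atLeast0)
    also have "(\<Sum>i=0..n. c i * c (n - i)) = 1 gchoose n"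
      unfolding c_def by (subst gbinomial_Vandermonde) simp
    finally show ?thesis .
  qed
  then have "(\<lambda>n. ((1::real) gchoose n) *\<^sub>R x ^ n) sums (suminf ?f * suminf ?f)"
    using Cauchy_product_sums[OF abs abs] by simp
  moreover have "(\<lambda>n. ((1::real) gchoose n) *\<^sub>R x ^ n) sums (\<Sum>n\<le>1. ((1::real) gchoose n) *\<^sub>R x ^ n)"
  proof (rule sums_finite)
    fix n :: nat assume "n \<notin> {..1}"
    then have "1 choose n = 0" by simp
    then have "((1::real) gchoose n) = 0"
      by (metis binomial_gbinomial of_nat_0 of_nat_1)
    then show "((1::real) gchoose n) *\<^sub>R x ^ n = 0" by simp
  qed simp
  ultimately have "suminf ?f * suminf ?f = 1 + x"
    by (simp add: sums_iff)
  with summable_norm_cancel[OF abs] that show thesis by blast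
qed

section \<open>Involution and C*-identity\<close>

declare star_star [simp] star_add [simp] star_mult [simp] scaleC_one [simp]

lemma scaleC_minus_one: "(- 1) *\<^sub>C x = - (x :: 'a::unital_cstar_algebra)"
  using scaleR_scaleC[of "- 1" x] by simp

lemma scaleC_zero_right: "c *\<^sub>C 0 = (0 :: 'a::unital_cstar_algebra)"
  using scaleC_add_right[of c 0 0] by simp

lemma scaleC_minus_right: "c *\<^sub>C (- x) = - (c *\<^sub>C x :: 'a::unital_cstar_algebra)"
  using scaleC_add_right[of c x "- x"] by (simp add: scaleC_zero_right eq_neg_iff_add_eq_0 add.commute)

lemma scaleC_minus_left: "(- c) *\<^sub>C x = - (c *\<^sub>C x :: 'a::unital_cstar_algebra)"
  using scaleC_scaleC[of "- 1" c x] by (simp add: scaleC_minus_one)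

lemma scaleC_diff_right: "c *\<^sub>C (x - y) = c *\<^sub>C x - (c *\<^sub>C y :: 'a::unital_cstar_algebra)"
  using scaleC_add_right[of c x "- y"] by (simp add: scaleC_minus_right)

lemma star_scaleR: "star (r *\<^sub>R x) = r *\<^sub>R star (x :: 'a::unital_cstar_algebra)"
  by (simp add: scaleR_scaleC star_scaleC)

lemma star_minus: "star (- x) = - star (x :: 'a::unital_cstar_algebra)"
  using star_scaleR[of "- 1" x] by simp

lemma star_diff: "star (x - y) = star x - star (y :: 'a::unital_cstar_algebra)"
  using star_add[of x "- y"] by (simp add: star_minus del: star_add)

lemma star_one: "star 1 = (1 :: 'a::unital_cstar_algebra)"
proof -
  have "star 1 * star (star 1) = star (star (1::'a) * 1)" by (simp only: star_mult)
  then show ?thesis by simp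
qed

lemma star_power: "star (x ^ n) = star (x :: 'a::unital_cstar_algebra) ^ n"
  by (induction n) (simp_all add: star_one power_commutes)

text \<open>The C*-identity and submultiplicativity give one inequality for all elements; applying
  it to \<open>star x\<close> gives the other.\<close>

lemma norm_star: "norm (star x) = norm (x :: 'a::unital_cstar_algebra)"
proof -
  have le: "norm x \<le> norm (star x)" for x :: 'a
  proof (cases "x = 0")
    case False
    then show ?thesis
      using norm_mult_ineq[of "star x" x] cstar_identity[of x] by (simp add: power2_eq_square)
  qed simp
  from le[of x] le[of "star x"] show ?thesis by simp
qed

lemma bounded_linear_star: "bounded_linear (star :: 'a::unital_cstar_algebra \<Rightarrow> 'a)"
  by (rule bounded_linear_intro[where K = 1]) (simp_all add: star_scaleR norm_star)

text \<open>The root is a power series in \<open>- x\<close> with real coefficients, so it inherits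
  self-adjointness and commutes with whatever commutes with \<open>x\<close>.\<close>

lemma exists_selfadjoint_sqrt:
  fixes x :: "'a::unital_cstar_algebra"
  assumes "norm x < 1" and "star x = x"
  obtains y where "y * y = 1 - x" "star y = y" "\<And>z. z * x = x * z \<Longrightarrow> z * y = y * z"
proof -
  obtain c :: "nat \<Rightarrow> real" where c: "summable (\<lambda>n. c n *\<^sub>R (- x) ^ n)"
    "(\<Sum>n. c n *\<^sub>R (- x) ^ n) * (\<Sum>n. c n *\<^sub>R (- x) ^ n) = 1 + - x"
    using exists_sqrt_one_plus[of "- x"] assms(1) unfolding norm_minus_cancel by blast
  let ?y = "\<Sum>n. c n *\<^sub>R (- x) ^ n"
  show thesis
  proof (rule that)
    show "?y * ?y = 1 - x" using c(2) by (simp only: diff_conv_add_uminus)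
    show "star ?y = ?y"
      using bounded_linear.suminf[OF bounded_linear_star c(1)]
      by (simp only: star_scaleR star_power star_minus assms(2))
    show "z * ?y = ?y * z" if "z * x = x * z" for z
      using that by (intro suminf_power_commute c(1)) simp
  qed
qed

lemma norm_selfadjoint_square:
  "star a = a \<Longrightarrow> norm (a * a) = (norm (a :: 'a::unital_cstar_algebra))\<^sup>2"
  using cstar_identity[of a] by simp

text \<open>Commutation makes the cross terms in \<open>star u * u\<close> cancel for
  \<open>u = a + \<i> *\<^sub>C d\<close>, and \<open>a\<close> is the real part of
  \<open>u\<close>, so its norm is at most \<open>norm u\<close>.\<close>

lemma norm_le_norm_sum_squares:
  fixes a d :: "'a::unital_cstar_algebra"
  assumes "star a = a" "star d = d" "a * d = d * a"
  shows "(norm a)\<^sup>2 \<le> norm (a * a + d * d)"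
proof -
  define u where "u = a + \<i> *\<^sub>C d"
  have star_u: "star u = a - \<i> *\<^sub>C d"
    by (simp add: u_def star_scaleC assms scaleC_minus_left)
  have "star u * u = a * a + d * d"
    unfolding star_u using assms(3)
    by (simp add: u_def algebra_simps mult_scaleC_left mult_scaleC_right scaleC_scaleC
        scaleC_minus_one scaleC_diff_right scaleC_add_right)
  then have "(norm u)\<^sup>2 = norm (a * a + d * d)" using cstar_identity[of u] by simp
  moreover have "2 *\<^sub>R a = u + star u" unfolding star_u by (simp add: u_def scaleR_2)
  then have "2 * norm a \<le> norm u + norm (star u)"
    using norm_triangle_ineq[of u "star u"] by (metis norm_scaleR abs_numeral)
  ultimately show ?thesis by (simp add: norm_star flip: \<open>(norm u)\<^sup>2 = _\<close>)
qed

text \<open>With \<open>p = (1 + a) / 2\<close> and \<open>q = (1 - a) / 2\<close>, norms of \<open>p\<close> and \<open>q\<close> below \<open>\<rho> < 1\<close> give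
  \<open>a\<^sup>2 + 4 (\<rho> - p) (\<rho> - q) = (2 \<rho> - 1)\<^sup>2\<close>, and the second summand is the square of a
  self-adjoint element.\<close>

lemma norm_one_plus_minus_selfadjoint:
  fixes a :: "'a::unital_cstar_algebra"
  assumes sa: "star a = a" and a: "norm a = 1"
  shows "norm (1 + a) = 2 \<or> norm (1 - a) = 2"
proof (rule ccontr)
  assume neg: "\<not> ?thesis"
  have le: "norm (1 + a) \<le> 2" "norm (1 - a) \<le> 2"
    using norm_triangle_ineq[of 1 a] norm_triangle_ineq4[of 1 a] a by auto
  define p q where "p = (1 / 2) *\<^sub>R (1 + a)" and "q = (1 / 2) *\<^sub>R (1 - a)"
  have "norm p < 1" "norm q < 1" using le neg by (auto simp: p_def q_def)
  then obtain r where r: "norm p < r" "norm q < r" "r < 1"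
    using dense[of "max (norm p) (norm q)" 1] by auto
  have pq: "q = 1 - p" and ap: "a = 2 *\<^sub>R p - 1"
  proof -
    have "p + q = (1 / 2) *\<^sub>R ((1 + a) + (1 - a))" by (simp only: p_def q_def scaleR_add_right)
    also have "(1 + a) + (1 - a) = 2 *\<^sub>R 1" by (simp add: scaleR_2)
    finally show "q = 1 - p" by (simp add: eq_diff_eq add.commute)
    show "a = 2 *\<^sub>R p - 1" by (simp add: p_def)
  qed
  then have "1 \<le> norm p + norm q" using norm_triangle_ineq[of p q] by (simp add: pq)
  with r have r0: "r > 1 / 2" by simp
  have sa': "star p = p" "star q = q" by (simp_all add: p_def q_def star_scaleR star_add star_diff star_one sa)
  \<comment> \<open>Dividing by \<open>r\<close> prepares square roots with
    \<open>r *\<^sub>R (y * y) = r *\<^sub>R 1 - p\<close>, and likewise for \<open>w\<close> and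
    \<open>q\<close>.\<close>
  have "norm (inverse r *\<^sub>R p) < 1" "norm (inverse r *\<^sub>R q) < 1"
    using r r0 by (simp_all add: field_simps)
  then obtain y w where y: "y * y = 1 - inverse r *\<^sub>R p" "star y = y"
      and yz: "\<And>z. z * (inverse r *\<^sub>R p) = (inverse r *\<^sub>R p) * z \<Longrightarrow> z * y = y * z"
      and w: "w * w = 1 - inverse r *\<^sub>R q" "star w = w"
      and wz: "\<And>z. z * (inverse r *\<^sub>R q) = (inverse r *\<^sub>R q) * z \<Longrightarrow> z * w = w * z"
    using exists_selfadjoint_sqrt sa' by (metis star_scaleR)
  \<comment> \<open>These commutation relations make \<open>d\<close> self-adjoint and let it
    commute with \<open>a\<close>.\<close>
  have ay: "a * y = y * a" by (rule yz) (simp add: p_def algebra_simps)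
  have aw: "a * w = w * a" by (rule wz) (simp add: q_def algebra_simps)
  have yw: "y * w = w * y" by (rule wz) (simp add: q_def ay algebra_simps)
  define d where "d = (2 * r) *\<^sub>R (y * w)"
  have "star d = d" by (simp add: d_def star_scaleR y w yw)
  moreover have "a * (y * w) = y * w * a" by (metis ay aw mult.assoc)
  then have "a * d = d * a" by (simp add: d_def)
  moreover have "a * a + d * d = ((2 * r - 1)\<^sup>2) *\<^sub>R 1"
  proof -
    have "y * w * (y * w) = y * y * (w * w)" by (metis yw mult.assoc)
    then have "d * d = (4 * r\<^sup>2) *\<^sub>R ((y * y) * (w * w))"
      by (simp add: d_def power2_eq_square)
    also have "\<dots> = 4 *\<^sub>R ((r *\<^sub>R 1 - p) * (r *\<^sub>R 1 - q))"
    proof -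
      have "r *\<^sub>R (y * y) = r *\<^sub>R 1 - p" "r *\<^sub>R (w * w) = r *\<^sub>R 1 - q"
        using r0 by (simp_all add: y w scaleR_diff_right)
      then show ?thesis by (simp add: power2_eq_square flip: \<open>r *\<^sub>R (y * y) = _\<close> \<open>r *\<^sub>R (w * w) = _\<close>)
    qed
    also have "\<dots> = (2 * r - 1)\<^sup>2 *\<^sub>R 1 - a * a"
    proof -
      have "4 *\<^sub>R p = 2 *\<^sub>R p + 2 *\<^sub>R p" by (simp flip: scaleR_add_left)
      then have "a * a = 4 *\<^sub>R (p * p) - 4 *\<^sub>R p + 1" by (simp add: ap algebra_simps)
      then show ?thesis by (simp add: pq algebra_simps power2_eq_square)
    qed
    finally show ?thesis by simp
  qed
  ultimately have "(norm a)\<^sup>2 \<le> norm (((2 * r - 1)\<^sup>2) *\<^sub>R (1::'a))"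
    using norm_le_norm_sum_squares[OF sa, of d] by metis
  moreover have "(2 * r - 1)\<^sup>2 < 1"
    using r r0 by (simp add: power_less_one_iff abs_square_less_1)
  ultimately show False by (simp add: a)
qed

subsection \<open>States\<close>

lemma onorm_eq_oneI:
  fixes \<phi> :: "'a::real_normed_algebra_1 \<Rightarrow> complex"
  assumes "bounded_linear \<phi>" "\<phi> 1 = 1" "\<And>x. cmod (\<phi> x) \<le> norm x"
  shows "onorm \<phi> = 1"
proof (rule antisym)
  show "onorm \<phi> \<le> 1" by (rule onorm_bound) (use assms(3) in auto)
  show "1 \<le> onorm \<phi>" using onorm[OF assms(1), of 1] assms(2) by simp
qed

lemma scaleC_eq_Re_Im:
  "c *\<^sub>C x = Re c *\<^sub>R x + Im c *\<^sub>R (\<i> *\<^sub>C x :: 'a::unital_cstar_algebra)"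
proof -
  have "c = of_real (Re c) + of_real (Im c) * \<i>" by (simp add: complex_eq_iff)
  then show ?thesis by (metis scaleC_add_left scaleC_scaleC scaleR_scaleC)
qed

text \<open>Complexification: the imaginary part is forced by complex linearity, and rotating
  \<open>\<phi> x\<close> onto the nonnegative reals transfers the norm bound from \<open>f\<close>.
  Real part 1 and modulus at most 1 then force \<open>\<phi> 1 = 1\<close>.\<close>

lemma exists_state_of_real_functional:
  fixes f :: "'a::unital_cstar_algebra \<Rightarrow> real"
  assumes f: "linear f" "\<And>x. f x \<le> norm x" "f 1 = 1"
  obtains \<phi> where "\<phi> \<in> states" "\<And>x. Re (\<phi> x) = f x"
proof -
  define \<phi> where "\<phi> x = Complex (f x) (- f (\<i> *\<^sub>C x))" for x
  have f_scale: "f (c *\<^sub>C x) = Re c * f x + Im c * f (\<i> *\<^sub>C x)" for c x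
    by (subst scaleC_eq_Re_Im) (simp only: linear_add[OF f(1)] linear_scale[OF f(1)] real_scaleR_def)
  have scale: "\<phi> (c *\<^sub>C x) = c * \<phi> x" for c x
    using f_scale[of c x] f_scale[of "\<i> * c" x]
    by (simp add: \<phi>_def complex_eq_iff scaleC_scaleC)
  have add: "\<phi> (x + y) = \<phi> x + \<phi> y" for x y
    by (simp add: \<phi>_def complex_eq_iff scaleC_add_right linear_add[OF f(1)])
  have le: "cmod (\<phi> x) \<le> norm x" for x
  proof -
    obtain t where t: "\<phi> x = of_real (cmod (\<phi> x)) * exp (\<i> * of_real t)"
      by (metis cis_conv_exp rcis_def rcis_cmod_Arg)
    have "\<phi> (exp (- (\<i> * of_real t)) *\<^sub>C x) = of_real (cmod (\<phi> x))"
      unfolding scale by (subst t) (simp flip: exp_add)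
    then have "cmod (\<phi> x) = f (exp (- (\<i> * of_real t)) *\<^sub>C x)"
      by (simp add: \<phi>_def complex_eq_iff)
    also have "\<dots> \<le> norm (exp (- (\<i> * of_real t)) *\<^sub>C x)" by (rule f(2))
    finally show ?thesis by (simp add: norm_scaleC)
  qed
  have bl: "bounded_linear \<phi>"
    by (rule bounded_linear_intro[where K = 1])
       (simp_all add: add scaleR_scaleC scale scaleR_conv_of_real le)
  have "cmod (\<phi> 1) \<le> 1" using le[of 1] by simp
  then have one: "\<phi> 1 = 1"
    using f(3) by (simp add: \<phi>_def cmod_def complex_eq_iff)
  have "\<phi> \<in> states"
    using bl scale one onorm_eq_oneI[OF bl one le] by (simp add: states_def dual_space_def)
  then show thesis by (rule that) (simp add: \<phi>_def)
qed

lemma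
  assumes "\<phi> \<in> states"
  shows state_one: "\<phi> 1 = 1" and state_scaleC: "\<phi> (c *\<^sub>C x) = c * \<phi> x"
    and state_add: "\<phi> (x + y) = \<phi> x + \<phi> y" and state_diff: "\<phi> (x - y) = \<phi> x - \<phi> y"
    and state_norm_le: "cmod (\<phi> x) \<le> norm x"
proof -
  have bl: "bounded_linear \<phi>" and on: "onorm \<phi> = 1"
    using assms by (auto simp: states_def dual_space_def)
  show "\<phi> 1 = 1" "\<phi> (c *\<^sub>C x) = c * \<phi> x"
    using assms by (auto simp: states_def dual_space_def)
  show "\<phi> (x + y) = \<phi> x + \<phi> y" "\<phi> (x - y) = \<phi> x - \<phi> y"
    using bl by (simp_all add: linear_simps)
  show "cmod (\<phi> x) \<le> norm x"
    using onorm[OF bl, of x] on by simp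
qed

text \<open>A functional norming \<open>1 + e *\<^sub>R b\<close> has value 2 there but at most 1 at
  each summand, hence exactly 1 at both; so it comes from a state.\<close>

lemma exists_state_norming_selfadjoint:
  fixes a :: "'a::unital_cstar_algebra"
  assumes sa: "star a = a"
  obtains \<phi> where "\<phi> \<in> states" "cmod (\<phi> a) = norm a"
proof -
  \<comment> \<open>The default 1 keeps \<open>b\<close> self-adjoint of norm one, with
    \<open>a = norm a *\<^sub>R b\<close>, even for \<open>a = 0\<close>.\<close>
  define b where "b = (if a = 0 then 1 else inverse (norm a) *\<^sub>R a)"
  have b: "star b = b" "norm b = 1" and a_b: "a = norm a *\<^sub>R b"
    by (auto simp: b_def star_one star_scaleR sa)
  obtain e :: real where e: "\<bar>e\<bar> = 1" "norm (1 + e *\<^sub>R b) = 2"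
  proof (cases "norm (1 + b) = 2")
    case True
    with that[of 1] show thesis by simp
  next
    case False
    with norm_one_plus_minus_selfadjoint[OF b] that[of "- 1"] show thesis by simp
  qed
  obtain f where f: "linear f" "\<And>x. f x \<le> norm x" "f (1 + e *\<^sub>R b) = norm (1 + e *\<^sub>R b)"
    using norming_functional by blast
  have "f 1 + f (e *\<^sub>R b) = 2" using f(3) e(2) by (simp add: linear_add[OF f(1)])
  moreover have "f 1 \<le> 1" "f (e *\<^sub>R b) \<le> 1" using f(2)[of 1] f(2)[of "e *\<^sub>R b"] b e by auto
  ultimately have f1: "f 1 = 1" and fb: "e * f b = 1" by (auto simp: linear_scale[OF f(1)])
  obtain \<phi> where \<phi>: "\<phi> \<in> states" "\<And>x. Re (\<phi> x) = f x"
    using exists_state_of_real_functional[OF f(1,2) f1] by blast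
  have "\<bar>e * f b\<bar> = 1" using fb by simp
  then have "\<bar>f b\<bar> = 1" using e(1) by (simp add: abs_mult)
  then have "\<bar>f a\<bar> = norm a"
    by (subst a_b) (simp add: linear_scale[OF f(1)] abs_mult)
  then have "norm a \<le> cmod (\<phi> a)" using abs_Re_le_cmod[of "\<phi> a"] \<phi>(2) by simp
  then have "cmod (\<phi> a) = norm a" using state_norm_le[OF \<phi>(1), of a] by simp
  with \<phi>(1) show thesis by (rule that)
qed

text \<open>The classical argument: \<open>\<parallel>a + it\<parallel>\<^sup>2 \<le> \<parallel>a\<parallel>\<^sup>2 + t\<^sup>2\<close> for all real \<open>t\<close> leaves no room for an
  imaginary part of \<open>\<phi> a\<close>.\<close>

lemma state_selfadjoint_real:
  assumes \<phi>: "\<phi> \<in> states" and sa: "star a = a"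
  shows "Im (\<phi> a) = 0"
proof (rule ccontr)
  assume "Im (\<phi> a) \<noteq> 0"
  define q where "q = Im (\<phi> a)"
  \<comment> \<open>Chosen so that \<open>q * t\<close> is the square of \<open>norm a\<close>: the
    term \<open>2 * q * t\<close> of the expanded square then exceeds the bound.\<close>
  define t where "t = (norm a)\<^sup>2 / q"
  define u where "u = a + (\<i> * of_real t) *\<^sub>C 1"
  have "star u * u = a * a + (t\<^sup>2) *\<^sub>R 1"
    by (simp add: u_def star_scaleC sa star_one algebra_simps mult_scaleC_left mult_scaleC_right
        scaleC_scaleC scaleC_minus_left scaleC_diff_right scaleR_scaleC power2_eq_square)
  then have "(norm u)\<^sup>2 \<le> norm (a * a) + t\<^sup>2"
    using cstar_identity[of u] norm_triangle_ineq[of "a * a" "t\<^sup>2 *\<^sub>R 1"] by simp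
  then have "(norm u)\<^sup>2 \<le> (norm a)\<^sup>2 + t\<^sup>2" by (simp add: norm_selfadjoint_square sa)
  moreover have "\<phi> u = \<phi> a + \<i> * of_real t"
    by (simp add: u_def state_add[OF \<phi>] state_scaleC[OF \<phi>] state_one[OF \<phi>])
  then have "(q + t)\<^sup>2 \<le> (cmod (\<phi> u))\<^sup>2" by (simp add: cmod_power2 q_def)
  moreover have "(cmod (\<phi> u))\<^sup>2 \<le> (norm u)\<^sup>2" using state_norm_le[OF \<phi>] by (intro power_mono) auto
  ultimately have "(q + t)\<^sup>2 \<le> (norm a)\<^sup>2 + t\<^sup>2" by linarith
  moreover have "q * t = (norm a)\<^sup>2" using \<open>Im (\<phi> a) \<noteq> 0\<close> by (simp add: t_def q_def)
  ultimately have "q\<^sup>2 + (norm a)\<^sup>2 \<le> 0" by (simp add: power2_sum mult.assoc)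
  moreover have "q\<^sup>2 > 0" using \<open>Im (\<phi> a) \<noteq> 0\<close> by (simp add: q_def)
  ultimately show False using zero_le_power2[of "norm a"] by linarith
qed

section \<open>Real and imaginary parts\<close>

lemma star_re_part: "star (re_part x) = re_part x"
  by (simp add: re_part_def star_scaleC add.commute)

lemma star_im_part: "star (im_part x) = im_part x"
  by (simp add: im_part_def star_scaleC star_diff scaleC_diff_right scaleC_minus_left)

lemma re_im_decomposition: "x = re_part x + \<i> *\<^sub>C im_part x"
  by (simp add: re_part_def im_part_def scaleC_scaleC scaleC_add_right scaleC_diff_right
      flip: scaleC_add_left)

text \<open>Uniqueness of the Cartesian decomposition, used to read off the parts of a rotated
  element.\<close>

lemma re_im_part_of_selfadjoint:
  assumes "star a = a" "star b = b"
  shows "re_part (a + \<i> *\<^sub>C b) = a" "im_part (a + \<i> *\<^sub>C b) = b"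
proof -
  have "2 *\<^sub>C y = y + y" for y :: 'a
    using scaleC_add_left[of 1 1 y] by simp
  then have double: "c *\<^sub>C (y + y) = (c * 2) *\<^sub>C y" for c and y :: 'a
    by (metis scaleC_scaleC)
  show "re_part (a + \<i> *\<^sub>C b) = a"
    using double[of "1 / 2" a] by (simp add: re_part_def star_scaleC assms scaleC_minus_left)
  show "im_part (a + \<i> *\<^sub>C b) = b"
    using double[of "1 / (2 * \<i>)" "\<i> *\<^sub>C b"]
    by (simp add: im_part_def star_scaleC assms scaleC_minus_left scaleC_scaleC)
qed

lemma re_im_part_scaleC:
  "re_part (c *\<^sub>C x) = Re c *\<^sub>R re_part x - Im c *\<^sub>R im_part x"
  "im_part (c *\<^sub>C x) = Im c *\<^sub>R re_part x + Re c *\<^sub>R im_part x"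
proof -
  have "c *\<^sub>C x = c *\<^sub>C re_part x + \<i> *\<^sub>C (c *\<^sub>C im_part x)"
    by (subst re_im_decomposition[of x])
       (simp add: scaleC_add_right scaleC_scaleC mult.commute)
  also have "\<dots> = (Re c *\<^sub>R re_part x - Im c *\<^sub>R im_part x)
      + \<i> *\<^sub>C (Im c *\<^sub>R re_part x + Re c *\<^sub>R im_part x)"
    by (simp add: scaleC_eq_Re_Im[of c] scaleR_scaleC scaleC_add_right scaleC_scaleC
        scaleC_minus_left mult.commute mult.left_commute)
  finally have "c *\<^sub>C x = \<dots>" .
  then show "re_part (c *\<^sub>C x) = Re c *\<^sub>R re_part x - Im c *\<^sub>R im_part x"
    "im_part (c *\<^sub>C x) = Im c *\<^sub>R re_part x + Re c *\<^sub>R im_part x"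
    by (simp_all only: re_im_part_of_selfadjoint star_scaleR star_add star_diff star_re_part star_im_part)
qed

lemma state_star:
  assumes \<phi>: "\<phi> \<in> states"
  shows "\<phi> (star x) = cnj (\<phi> x)"
proof -
  have "star x = re_part x - \<i> *\<^sub>C im_part x"
    by (subst re_im_decomposition[of x]) (simp add: star_scaleC star_re_part star_im_part scaleC_minus_left)
  then have "\<phi> (star x) = \<phi> (re_part x) - \<i> * \<phi> (im_part x)"
    by (simp add: state_diff[OF \<phi>] state_scaleC[OF \<phi>])
  moreover have "\<phi> x = \<phi> (re_part x) + \<i> * \<phi> (im_part x)"
    by (subst re_im_decomposition[of x]) (simp add: state_add[OF \<phi>] state_scaleC[OF \<phi>])
  ultimately show ?thesis
    using state_selfadjoint_real[OF \<phi> star_re_part[of x]] state_selfadjoint_real[OF \<phi> star_im_part[of x]]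
    by (simp add: complex_eq_iff)
qed

lemma state_re_part:
  assumes \<phi>: "\<phi> \<in> states"
  shows "\<phi> (re_part x) = of_real (Re (\<phi> x))"
  by (simp add: re_part_def state_add[OF \<phi>] state_scaleC[OF \<phi>] state_star[OF \<phi>] complex_eq_iff)

section \<open>Numerical radius and real parts of rotations\<close>

lemma bdd_above_states: "bdd_above ((\<lambda>\<phi>. cmod (\<phi> x)) ` states)"
  by (rule bdd_aboveI2[where M = "norm x"]) (rule state_norm_le)

lemma norm_re_part_le_numerical_radius: "norm (re_part x) \<le> numerical_radius x"
proof -
  obtain \<phi> where \<phi>: "\<phi> \<in> states" "cmod (\<phi> (re_part x)) = norm (re_part x)"
    using exists_state_norming_selfadjoint[OF star_re_part] by blast
  then have "norm (re_part x) \<le> cmod (\<phi> x)"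
    using abs_Re_le_cmod[of "\<phi> x"] by (simp add: state_re_part[OF \<phi>(1)])
  also have "\<dots> \<le> numerical_radius x"
    unfolding numerical_radius_def by (rule cSUP_upper[OF \<phi>(1) bdd_above_states])
  finally show ?thesis .
qed

text \<open>For each state, rotating \<open>x\<close> by the opposite of the phase of
  \<open>\<phi> x\<close> makes the value real and nonnegative, so the real part of the rotated
  element already has the value \<open>cmod (\<phi> x)\<close>.\<close>

lemma numerical_radius_leI:
  assumes "\<And>\<theta>. norm (re_part (exp (\<i> * of_real \<theta>) *\<^sub>C x)) \<le> M"
  shows "numerical_radius x \<le> M"
  unfolding numerical_radius_def
proof (rule cSUP_least)
  show "(states :: ('a \<Rightarrow> complex) set) \<noteq> {}"
    using exists_state_norming_selfadjoint[OF star_one] by blast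
next
  fix \<phi> :: "'a \<Rightarrow> complex" assume \<phi>: "\<phi> \<in> states"
  obtain t where t: "\<phi> x = of_real (cmod (\<phi> x)) * exp (\<i> * of_real t)"
    by (metis cis_conv_exp rcis_def rcis_cmod_Arg)
  have "\<phi> (exp (\<i> * of_real (- t)) *\<^sub>C x) = of_real (cmod (\<phi> x))"
    unfolding state_scaleC[OF \<phi>] by (subst t) (simp flip: exp_add)
  then have "cmod (\<phi> (re_part (exp (\<i> * of_real (- t)) *\<^sub>C x))) = cmod (\<phi> x)"
    by (simp add: state_re_part[OF \<phi>])
  then show "cmod (\<phi> x) \<le> M"
    using state_norm_le[OF \<phi>, of "re_part (exp (\<i> * of_real (- t)) *\<^sub>C x)"] assms[of "- t"] by linarith
qed

lemma numerical_radius_rotate: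
  assumes "cmod c = 1"
  shows "numerical_radius (c *\<^sub>C x) = numerical_radius x"
  unfolding numerical_radius_def
  by (rule SUP_cong) (simp_all add: state_scaleC norm_mult assms)

lemma norm_im_part_le_numerical_radius: "norm (im_part x) \<le> numerical_radius x"
proof -
  have "im_part x = re_part ((- \<i>) *\<^sub>C x)" by (simp add: re_im_part_scaleC)
  then show ?thesis
    using norm_re_part_le_numerical_radius[of "(- \<i>) *\<^sub>C x"] numerical_radius_rotate[of "- \<i>" x] by simp
qed

lemma norm_le_re_im: "norm x \<le> norm (re_part x) + norm (im_part x)"
  using norm_triangle_ineq[of "re_part x" "\<i> *\<^sub>C im_part x"] re_im_decomposition[of x]
  by (simp add: norm_scaleC)

text \<open>A state \<open>\<phi>\<close> norming \<open>x\<^sup>* x = a\<^sup>2 + b\<^sup>2 + i (ab - ba)\<close> must attain the trivial bound of each of the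
  three summands, all with the same sign. For the last one this makes \<open>\<phi> (ab)\<close> purely imaginary,
  so \<open>\<phi>\<close> does not see the cross terms in \<open>(a \<plusminus> b)\<^sup>2\<close>.\<close>

lemma norm_sum_diff_selfadjoint_ge:
  fixes a b :: "'a::unital_cstar_algebra"
  assumes sa: "star a = a" "star b = b"
    and eq: "norm (a + \<i> *\<^sub>C b) = norm a + norm b"
  shows "(norm a)\<^sup>2 + (norm b)\<^sup>2 \<le> (norm (a + b))\<^sup>2"
    and "(norm a)\<^sup>2 + (norm b)\<^sup>2 \<le> (norm (a - b))\<^sup>2"
proof -
  define x where "x = a + \<i> *\<^sub>C b"
  have xx: "star x * x = a * a + b * b + \<i> *\<^sub>C (a * b - b * a)"
    by (simp add: x_def star_scaleC sa algebra_simps mult_scaleC_left mult_scaleC_right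
        scaleC_scaleC scaleC_minus_left scaleC_diff_right)
  have "star (star x * x) = star x * x" by simp
  then obtain \<phi> where \<phi>: "\<phi> \<in> states" and "cmod (\<phi> (star x * x)) = norm (star x * x)"
    by (rule exists_state_norming_selfadjoint)
  then have norming: "cmod (\<phi> (star x * x)) = (norm a + norm b)\<^sup>2"
    using eq by (simp only: cstar_identity x_def)
  define A B m where "A = Re (\<phi> (a * a))" and "B = Re (\<phi> (b * b))" and "m = \<phi> (a * b)"
  have A: "\<phi> (a * a) = of_real A" and B: "\<phi> (b * b) = of_real B"
    using state_selfadjoint_real[OF \<phi>, of "a * a"] state_selfadjoint_real[OF \<phi>, of "b * b"]
    by (simp_all add: A_def B_def sa complex_eq_iff)
  have "\<phi> (b * a) = cnj m" using state_star[OF \<phi>, of "a * b"] by (simp add: m_def sa)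
  note \<phi>_simps = state_add[OF \<phi>] state_diff[OF \<phi>] state_scaleC[OF \<phi>] A B this m_def[symmetric]
  \<comment> \<open>The commutator contributes \<open>\<i> * (m - cnj m)\<close>, which is
    \<open>- 2 * Im m\<close>.\<close>
  have "\<phi> (star x * x) = of_real (A + B - 2 * Im m)"
    unfolding xx by (simp add: \<phi>_simps complex_eq_iff)
  then have norming': "\<bar>A + B - 2 * Im m\<bar> = (norm a + norm b)\<^sup>2"
    using norming by (simp only: norm_of_real)
  have "\<bar>A\<bar> \<le> (norm a)\<^sup>2" "\<bar>B\<bar> \<le> (norm b)\<^sup>2"
    using state_norm_le[OF \<phi>, of "a * a"] state_norm_le[OF \<phi>, of "b * b"]
    by (simp_all add: A B norm_selfadjoint_square sa)
  moreover have m: "cmod m \<le> norm a * norm b"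
    using state_norm_le[OF \<phi>, of "a * b"] norm_mult_ineq[of a b] by (simp add: m_def)
  moreover have "\<bar>Im m\<bar> \<le> cmod m" by (rule abs_Im_le_cmod)
  moreover have "(norm a + norm b)\<^sup>2 = (norm a)\<^sup>2 + (norm b)\<^sup>2 + 2 * (norm a * norm b)"
    by (simp add: power2_sum)
  ultimately have AB: "\<bar>A + B\<bar> = (norm a)\<^sup>2 + (norm b)\<^sup>2" and Im: "\<bar>Im m\<bar> = norm a * norm b"
    using norming' by linarith+
  have "(cmod m)\<^sup>2 \<le> (Im m)\<^sup>2"
    using m Im by (metis norm_ge_zero power2_abs power_mono)
  then have "Re m = 0" by (simp add: cmod_power2)
  then have "\<phi> ((a + b) * (a + b)) = of_real (A + B)" "\<phi> ((a - b) * (a - b)) = of_real (A + B)"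
    by (simp_all add: algebra_simps \<phi>_simps complex_eq_iff)
  then have "\<bar>A + B\<bar> \<le> norm ((a + b) * (a + b))" "\<bar>A + B\<bar> \<le> norm ((a - b) * (a - b))"
    using state_norm_le[OF \<phi>] by (metis norm_of_real)+
  then show "(norm a)\<^sup>2 + (norm b)\<^sup>2 \<le> (norm (a + b))\<^sup>2" "(norm a)\<^sup>2 + (norm b)\<^sup>2 \<le> (norm (a - b))\<^sup>2"
    by (simp_all add: AB norm_selfadjoint_square sa star_diff)
qed

text \<open>The first hypothesis bounds \<open>norm (a + b)\<close> and \<open>norm (a - b)\<close>
  below by \<open>s\<close>; the second turns this into
  \<open>sqrt 2 * s \<le> norm a + norm b\<close>. Squaring leaves a square of
  \<open>norm a - norm b\<close> that is at most 0.\<close>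

lemma norm_re_part_eq_norm_im_part:
  fixes y :: "'a::unital_cstar_algebra"
  assumes y: "norm y = norm (re_part y) + norm (im_part y)"
    and rot: "norm y = norm (re_part (exp (\<i> * of_real (pi / 4)) *\<^sub>C y))
      + norm (im_part (exp (\<i> * of_real (pi / 4)) *\<^sub>C y))"
  shows "norm (re_part y) = norm (im_part y)"
proof -
  define a b s where "a = re_part y" and "b = im_part y" and "s = sqrt ((norm a)\<^sup>2 + (norm b)\<^sup>2)"
  have "norm (a + \<i> *\<^sub>C b) = norm a + norm b"
    using y by (simp add: a_def b_def flip: re_im_decomposition)
  then have "s \<le> norm (a + b)" "s \<le> norm (a - b)"
    unfolding s_def by (auto intro!: real_le_lsqrt norm_sum_diff_selfadjoint_ge
        simp: a_def b_def star_re_part star_im_part)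
  moreover
  have "exp (\<i> * of_real (pi / 4)) = Complex (sqrt 2 / 2) (sqrt 2 / 2)"
    by (simp add: complex_eq_iff Re_exp Im_exp cos_45 sin_45)
  then have "norm y = sqrt 2 / 2 * norm (a - b) + sqrt 2 / 2 * norm (a + b)"
    using rot by (simp add: re_im_part_scaleC a_def b_def flip: scaleR_diff_right scaleR_add_right)
  moreover have "sqrt 2 / 2 * s + sqrt 2 / 2 * s \<le> sqrt 2 / 2 * norm (a - b) + sqrt 2 / 2 * norm (a + b)"
    using \<open>s \<le> norm (a + b)\<close> \<open>s \<le> norm (a - b)\<close> by (intro add_mono mult_left_mono) simp_all
  ultimately have "sqrt 2 / 2 * s + sqrt 2 / 2 * s \<le> norm a + norm b"
    using y unfolding a_def b_def by linarith
  then have "sqrt 2 * s \<le> norm a + norm b" by (simp add: mult.commute)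
  then have "(sqrt 2 * s)\<^sup>2 \<le> (norm a + norm b)\<^sup>2"
    by (rule power_mono) (simp add: s_def)
  then have "2 * ((norm a)\<^sup>2 + (norm b)\<^sup>2) \<le> (norm a + norm b)\<^sup>2"
    by (simp add: s_def power_mult_distrib)
  then have "(norm a - norm b)\<^sup>2 \<le> 0"
    by (simp add: power2_sum power2_diff)
  then show ?thesis by (simp add: a_def b_def)
qed

theorem theorem2p8:
  fixes x :: "'a::unital_cstar_algebra"
  shows "numerical_radius x = 1 / 2 * norm x \<longleftrightarrow>
    (\<forall>\<theta>::real. norm x = norm (re_part (exp (\<i> * complex_of_real \<theta>) *\<^sub>C x))
                     + norm (im_part (exp (\<i> * complex_of_real \<theta>) *\<^sub>C x)))"
proof
  assume v: "numerical_radius x = 1 / 2 * norm x"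
  show "\<forall>\<theta>::real. norm x = norm (re_part (exp (\<i> * complex_of_real \<theta>) *\<^sub>C x))
                     + norm (im_part (exp (\<i> * complex_of_real \<theta>) *\<^sub>C x))"
  proof
    fix \<theta> :: real
    let ?y = "exp (\<i> * complex_of_real \<theta>) *\<^sub>C x"
    have "norm ?y = norm x" "numerical_radius ?y = 1 / 2 * norm x"
      using v by (simp_all add: norm_scaleC numerical_radius_rotate)
    \<comment> \<open>Both parts are at most \<open>norm x / 2\<close> in norm, so the triangle
      inequality is an equality.\<close>
    then show "norm x = norm (re_part ?y) + norm (im_part ?y)"
      using norm_le_re_im[of ?y] norm_re_part_le_numerical_radius[of ?y]
        norm_im_part_le_numerical_radius[of ?y] by linarith
  qed
next
  assume eq: "\<forall>\<theta>::real. norm x = norm (re_part (exp (\<i> * complex_of_real \<theta>) *\<^sub>C x))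
                     + norm (im_part (exp (\<i> * complex_of_real \<theta>) *\<^sub>C x))"
  have half: "norm (re_part (exp (\<i> * complex_of_real \<theta>) *\<^sub>C x)) = 1 / 2 * norm x" for \<theta>
  proof -
    let ?y = "exp (\<i> * complex_of_real \<theta>) *\<^sub>C x"
    have y: "norm x = norm (re_part ?y) + norm (im_part ?y)" using eq by blast
    \<comment> \<open>The further rotation stays in the family of angles covered by
      \<open>eq\<close>.\<close>
    have "exp (\<i> * of_real (pi / 4)) *\<^sub>C ?y = exp (\<i> * complex_of_real (pi / 4 + \<theta>)) *\<^sub>C x"
      by (simp add: scaleC_scaleC distrib_left flip: exp_add)
    then have "norm x = norm (re_part (exp (\<i> * of_real (pi / 4)) *\<^sub>C ?y))
        + norm (im_part (exp (\<i> * of_real (pi / 4)) *\<^sub>C ?y))"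
      using eq by presburger
    then have "norm (re_part ?y) = norm (im_part ?y)"
      using y by (intro norm_re_part_eq_norm_im_part) (simp_all only: norm_scaleC norm_exp_i_times mult_1)
    with y show ?thesis by simp
  qed
  have "numerical_radius x \<le> 1 / 2 * norm x"
    by (rule numerical_radius_leI) (simp only: half)
  \<comment> \<open>The angle 0 alone gives the lower bound.\<close>
  moreover have "1 / 2 * norm x \<le> numerical_radius x"
    using half[of 0] norm_re_part_le_numerical_radius[of x] by simp
  ultimately show "numerical_radius x = 1 / 2 * norm x" by simp
qed

end
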